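(* Let $X$ be a non-empty Lindelöf locally compact Hausdorff space and let $\mathcal{I}$ be a Riesz ideal and unital subalgebra of $C(X)$ that contains a proper function $p\in\mathcal{I}^+$. Then every positive linear map $\Phi\colon\mathcal{I}\to V$ into an Archimedean ordered vector space $V$ is strictly $\mathcal{I}$-continuous.
   Context: $C(X)$ is the algebra of real-valued continuous functions on $X$ with pointwise operations and pointwise order; $|f|$ is the pointwise absolute value. A Riesz ideal of $C(X)$ is a linear subspace $\mathcal{I}\subseteq C(X)$ such that $f\in C(X)$, $g\in\mathcal{I}$ and $|f|\le|g|$ imply $f\in\mathcal{I}$; $\mathcal{I}^+$ denotes the set of functions in $\mathcal{I}$ that are $\ge 0$. A unital subalgebra of $C(X)$ is a linear subspace closed under multiplication and containing the constant function $1$. A function $p\in C(X)$ is proper if $p^{-1}([a,b])$ is compact for all real $a\le b$. An ordered vector space is a real vector space $V$ with a partial order $\le$ such that $u\le v$ implies $\lambda u\le\lambda v$ and $u+w\le v+w$ for all $\lambda\in[0,\infty)$, $w\in V$; $V^+=\{v\in V: v\ge 0\}$. It is Archimedean if whenever $v\in V$, $w\in V^+$ satisfy $v\le\epsilon w$ for all $\epsilon\in(0,\infty)$, then $v\le 0$. A linear map $\Phi\colon\mathcal{I}\to V$ is positive if $\Phi(f)\in V^+$ for all $f\in\mathcal{I}^+$. A positive linear map $\Phi\colon\mathcal{I}\to V$ is strictly $\mathcal{I}$-continuous if for every decreasing sequence $(f_k)_{k\in\mathbb{N}}$ in $\mathcal{I}$ with pointwise infimum $0$ (i.e. $\inf_k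 f_k(x)=0$ for all $x\in X$), the decreasing sequence $(\Phi(f_k))_{k\in\mathbb{N}}$ in $V$ has infimum $0$. *)

theory Defs
  imports
    "HOL-Analysis.Analysis"
    "HOL-Library.Function_Algebras"
    "HOL-Library.Lub_Glb"
begin

text \<open>Together with \<^theory>\<open>HOL-Library.Function_Algebras\<close> and the pointwise order on functions
  from Main, this makes the library notion \<^const>\<open>subspace\<close> available for sets of functions.\<close>

instantiation "fun" :: (type, real_vector) real_vector
begin

definition scaleR_fun_def: "c *\<^sub>R f = (\<lambda>x. c *\<^sub>R f x)"

instance
  by standard (simp_all add: scaleR_fun_def fun_eq_iff scaleR_add_right scaleR_add_left)

end

lemma scaleR_fun_apply [simp]: "(c *\<^sub>R f) x = c *\<^sub>R f x"
  by (simp add: scaleR_fun_def)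

definition continuous_functions :: "('a::topological_space \<Rightarrow> real) set" where
  "continuous_functions = {f. continuous_on UNIV f}"

definition riesz_ideal :: "('a::topological_space \<Rightarrow> real) set \<Rightarrow> bool" where
  "riesz_ideal I \<longleftrightarrow>
     I \<subseteq> continuous_functions \<and> subspace I \<and>
     (\<forall>f\<in>continuous_functions. \<forall>g\<in>I. (\<forall>x. \<bar>f x\<bar> \<le> \<bar>g x\<bar>) \<longrightarrow> f \<in> I)"

definition unital_subalgebra :: "('a::topological_space \<Rightarrow> real) set \<Rightarrow> bool" where
  "unital_subalgebra I \<longleftrightarrow>
     I \<subseteq> continuous_functions \<and> subspace I \<and> (\<forall>f\<in>I. \<forall>g\<in>I. f * g \<in> I) \<and> 1 \<in> I"

definition proper_function :: "('a::topological_space \<Rightarrow> real) \<Rightarrow> bool" where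
  "proper_function p \<longleftrightarrow>
     p \<in> continuous_functions \<and> (\<forall>a b. a \<le> b \<longrightarrow> compact (p -` {a..b}))"

text \<open>The ordered vector spaces are those of class \<^class>\<open>ordered_real_vector\<close>; its axiom
  \<open>scaleR_right_mono\<close> follows from the other ones.\<close>

class archimedean_ordered_real_vector = ordered_real_vector +
  assumes archimedean: "0 \<le> w \<Longrightarrow> (\<And>\<epsilon>::real. 0 < \<epsilon> \<Longrightarrow> v \<le> \<epsilon> *\<^sub>R w) \<Longrightarrow> v \<le> 0"

text \<open>A map defined on \<open>I\<close> is represented by a total function; only its values on \<open>I\<close> matter.\<close>

definition positive_linear_map ::
  "('a::topological_space \<Rightarrow> real) set \<Rightarrow> (('a \<Rightarrow> real) \<Rightarrow> 'v::ordered_real_vector) \<Rightarrow> bool" where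
  "positive_linear_map I \<Phi> \<longleftrightarrow>
     (\<forall>f\<in>I. \<forall>g\<in>I. \<Phi> (f + g) = \<Phi> f + \<Phi> g) \<and>
     (\<forall>c. \<forall>f\<in>I. \<Phi> (c *\<^sub>R f) = c *\<^sub>R \<Phi> f) \<and>
     (\<forall>f\<in>I. 0 \<le> f \<longrightarrow> 0 \<le> \<Phi> f)"

text \<open>Infima are expressed by \<^const>\<open>isGlb\<close>, as \<^const>\<open>Inf\<close> is not available in a general ordered
  vector space and is unspecified for real sequences that are unbounded below.\<close>

definition strictly_continuous ::
  "('a::topological_space \<Rightarrow> real) set \<Rightarrow> (('a \<Rightarrow> real) \<Rightarrow> 'v::ordered_real_vector) \<Rightarrow> bool" where
  "strictly_continuous I \<Phi> \<longleftrightarrow>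
     (\<forall>f :: nat \<Rightarrow> 'a \<Rightarrow> real.
        range f \<subseteq> I \<longrightarrow> decseq f \<longrightarrow> (\<forall>x. isGlb UNIV (range (\<lambda>k. f k x)) 0) \<longrightarrow>
        isGlb UNIV (range (\<lambda>k. \<Phi> (f k))) 0)"

end

theory Submission
  imports Defs
begin

text \<open>Let \<open>f\<close> decrease to \<open>0\<close> pointwise. Uniform convergence may fail, but the growth of \<open>p\<close> controls
  what happens at infinity: for every \<open>\<epsilon> > 0\<close> the inequality \<open>f k \<le> \<epsilon> (1 + p f 0)\<close> holds for some
  \<open>k\<close>. On the compact set where \<open>p \<le> 1 / \<epsilon>\<close> this is Dini's theorem, which gives \<open>f k \<le> \<epsilon>\<close>;
  elsewhere \<open>1 < \<epsilon> p\<close>, so that \<open>f k \<le> f 0 \<le> \<epsilon> p f 0\<close> (lemma \<open>decseq_relatively_uniform\<close>). The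
  weight \<open>1 + p f 0\<close> lies in the algebra and does not depend on \<open>\<epsilon>\<close>. Hence every lower bound of
  the images \<open>\<Phi> (f k)\<close> is at most \<open>\<epsilon> \<Phi> (1 + p f 0)\<close> for all \<open>\<epsilon> > 0\<close>, and the Archimedean
  property forces it to be at most \<open>0\<close>.\<close>

lemma isGlb_UNIV_0_iff:
  fixes a :: "nat \<Rightarrow> 'b::{order, zero}"
  shows "isGlb UNIV (range a) 0 \<longleftrightarrow> (\<forall>k. 0 \<le> a k) \<and> (\<forall>v. (\<forall>k. v \<le> a k) \<longrightarrow> v \<le> 0)"
  by (auto simp: isGlb_def greatestP_def isLb_def setge_def setle_def)

text \<open>Dini's theorem: the sets where \<open>f k\<close> is below \<open>e\<close> form an increasing open cover of \<open>K\<close>.\<close>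

lemma dini_decseq:
  fixes f :: "nat \<Rightarrow> 'a::topological_space \<Rightarrow> real"
  assumes "compact K"
    and cont: "\<And>k. continuous_on UNIV (f k)"
    and dec: "decseq f"
    and below: "\<And>x. x \<in> K \<Longrightarrow> \<exists>k. f k x < e"
  shows "\<exists>k. \<forall>x\<in>K. f k x < e"
proof -
  have "open {x. f k x < e}" for k
    using cont by (intro open_Collect_less) auto
  moreover have "K \<subseteq> (\<Union>k\<in>UNIV. {x. f k x < e})"
    using below by blast
  ultimately obtain C where C: "finite C" "K \<subseteq> (\<Union>k\<in>C. {x. f k x < e})"
    using compactE_image[OF \<open>compact K\<close>, of UNIV "\<lambda>k. {x. f k x < e}"] by metis
  have "f (Max C) x < e" if x: "x \<in> K" for x
  proof -
    obtain k where k: "k \<in> C" "f k x < e"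
      using C x by blast
    have "f (Max C) x \<le> f k x"
      using decseqD[OF dec, of k "Max C"] C(1) k(1) by (simp add: le_fun_def)
    with k show ?thesis
      by simp
  qed
  then show ?thesis
    by blast
qed

lemma decseq_relatively_uniform:
  fixes f :: "nat \<Rightarrow> 'a::topological_space \<Rightarrow> real"
  assumes "0 < e"
    and cont: "\<And>k. continuous_on UNIV (f k)"
    and dec: "decseq f"
    and glb: "\<And>x. isGlb UNIV (range (\<lambda>k. f k x)) 0"
    and p: "0 \<le> p" "proper_function p"
  shows "\<exists>k. f k \<le> e *\<^sub>R (1 + p * f 0)"
proof -
  have nonneg: "0 \<le> f k x" for k x
    using glb[of x] by (simp add: isGlb_UNIV_0_iff)
  have p0: "0 \<le> p x" for x
    using p(1) by (simp add: le_fun_def)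
  define K where "K = p -` {0..1 / e}"
  have "compact K"
    using p(2) \<open>0 < e\<close> by (simp add: proper_function_def K_def)
  moreover have "\<exists>k. f k x < e" for x
    using glb[of x] \<open>0 < e\<close> by (force simp: isGlb_UNIV_0_iff not_less)
  ultimately obtain k where k: "\<And>x. x \<in> K \<Longrightarrow> f k x < e"
    using dini_decseq[OF _ cont dec] by metis
  have "f k x \<le> e * (1 + p x * f 0 x)" for x
  proof (cases "x \<in> K")
    case True
    have "0 \<le> e * (p x * f 0 x)"
      using \<open>0 < e\<close> p0 nonneg by simp
    with k[OF True] show ?thesis
      by (simp add: distrib_left)
  next
    case False
    then have "1 \<le> e * p x"
      using p0[of x] \<open>0 < e\<close> by (simp add: K_def field_simps)
    then have "f 0 x \<le> e * p x * f 0 x"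
      using mult_right_mono[of 1 "e * p x" "f 0 x"] nonneg by simp
    moreover have "f k x \<le> f 0 x"
      using decseqD[OF dec, of 0 k] by (simp add: le_fun_def)
    ultimately show ?thesis
      using \<open>0 < e\<close> by (simp add: distrib_left mult.assoc)
  qed
  then show ?thesis
    by (auto simp: le_fun_def)
qed

lemma positive_linear_map_mono:
  assumes "positive_linear_map I \<Phi>" "subspace I" "f \<in> I" "g \<in> I" "f \<le> g"
  shows "\<Phi> f \<le> \<Phi> g"
proof -
  have "g - f \<in> I"
    using assms by (simp add: subspace_diff)
  moreover have "0 \<le> g - f"
    using assms(5) by (simp add: le_fun_def)
  ultimately have "0 \<le> \<Phi> (g - f)" "\<Phi> (f + (g - f)) = \<Phi> f + \<Phi> (g - f)"
    using assms unfolding positive_linear_map_def by blast+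
  then show ?thesis
    by simp
qed

theorem theorem5p3:
  fixes I :: "('a::t2_space \<Rightarrow> real) set"
    and p :: "'a \<Rightarrow> real"
    and \<Phi> :: "('a \<Rightarrow> real) \<Rightarrow> 'v::archimedean_ordered_real_vector"
  assumes "Lindelof_space (euclidean :: 'a topology)"
    and "locally_compact_space (euclidean :: 'a topology)"
    and "riesz_ideal I"
    and "unital_subalgebra I"
    and "p \<in> I" and "0 \<le> p" and "proper_function p"
    and "positive_linear_map I \<Phi>"
  shows "strictly_continuous I \<Phi>"
  unfolding strictly_continuous_def
proof (intro allI impI)
  fix f :: "nat \<Rightarrow> 'a \<Rightarrow> real"
  assume ran: "range f \<subseteq> I" and dec: "decseq f"
    and glb: "\<forall>x. isGlb UNIV (range (\<lambda>k. f k x)) 0"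
  have sub: "subspace I" and mult: "\<And>g h. g \<in> I \<Longrightarrow> h \<in> I \<Longrightarrow> g * h \<in> I" and one: "1 \<in> I"
    and cont_I: "\<And>g. g \<in> I \<Longrightarrow> continuous_on UNIV g"
    using \<open>unital_subalgebra I\<close> by (auto simp: unital_subalgebra_def continuous_functions_def)
  have pos: "\<And>g. g \<in> I \<Longrightarrow> 0 \<le> g \<Longrightarrow> 0 \<le> \<Phi> g"
    and scale: "\<And>c g. g \<in> I \<Longrightarrow> \<Phi> (c *\<^sub>R g) = c *\<^sub>R \<Phi> g"
    using \<open>positive_linear_map I \<Phi>\<close> by (auto simp: positive_linear_map_def)
  have fI: "f k \<in> I" for k
    using ran by blast
  have f0: "0 \<le> f k" for k
    using glb by (simp add: isGlb_UNIV_0_iff le_fun_def)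
  define w where "w = 1 + p * f 0"
  have wI: "w \<in> I"
    unfolding w_def using sub mult one \<open>p \<in> I\<close> fI by (intro subspace_add) auto
  have "0 \<le> w"
    using f0[of 0] \<open>0 \<le> p\<close> by (simp add: w_def le_fun_def)
  have "v \<le> 0" if v: "\<And>k. v \<le> \<Phi> (f k)" for v
  proof (rule archimedean)
    show "0 \<le> \<Phi> w"
      using pos wI \<open>0 \<le> w\<close> by blast
  next
    fix e :: real
    assume "0 < e"
    then obtain k where k: "f k \<le> e *\<^sub>R w"
      using decseq_relatively_uniform[of e f p] cont_I fI dec glb \<open>0 \<le> p\<close> \<open>proper_function p\<close>
      unfolding w_def by blast
    have "v \<le> \<Phi> (f k)"
      by (rule v)
    also have "\<dots> \<le> \<Phi> (e *\<^sub>R w)"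
      using positive_linear_map_mono[OF \<open>positive_linear_map I \<Phi>\<close> sub fI _ k] wI sub
      by (simp add: subspace_scale)
    also have "\<dots> = e *\<^sub>R \<Phi> w"
      using scale wI by blast
    finally show "v \<le> e *\<^sub>R \<Phi> w" .
  qed
  then show "isGlb UNIV (range (\<lambda>k. \<Phi> (f k))) 0"
    using pos fI f0 by (simp add: isGlb_UNIV_0_iff)
qed

end
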